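(* For $Z\in\{F,R,FT,RT\}$ and any two BCCSP processes $p,q$: $p\sqsubseteq_Z q$ if and only if $p\sqsubseteq_{RS}^{\Rightarrow_Z}q$, i.e. $q$ ready-simulates $p$ in the labelled transition system $(\mathrm{BCCSP},\mathit{Act},\Rightarrow_Z)$.
   Context: BCCSP processes over a set $\mathit{Act}$: $p ::= \mathbf{0}\mid ap\mid p+q$, considered modulo the axioms $x+y=y+x$, $(x+y)+z=x+(y+z)$, $x+x=x$, $x+\mathbf{0}=x$. Transitions $\to$: $ap\xrightarrow{a}p$, and $p\xrightarrow{a}p'$ implies $p+q\xrightarrow{a}p'$ and $q+p\xrightarrow{a}p'$; $p\overset{\alpha}{\Rightarrow}q$ for sequences. $I(p)=\{a\mid\exists p'.\,p\xrightarrow{a}p'\}$. Preorders: $p\sqsubseteq_F q$ / $p\sqsubseteq_R q$ iff $\{(\alpha,X)\mid \exists p'.\,p\overset{\alpha}{\Rightarrow}p'$ with $I(p')\cap X=\emptyset$ / with $I(p')=X\}$ is included in the same set for $q$; $p\sqsubseteq_{FT}q$ / $p\sqsubseteq_{RT}q$ iff every sequence $X_0a_1\cdots a_nX_n$ for which some path $p=p_0\xrightarrow{a_1}\cdots\xrightarrow{a_n}p_n$ has $I(p_i)\cap X_i=\emptyset$ / $I(p_i)=X_i$ for all $i$ has the same property for $q$. Conditions: $M_F$ always true; $M_R(x,y,w)\iff I(x)\supseteq I(y)$; $M_{FT}(x,y,w)\iff I(w)\subseteq I(y)$; $M_{RT}(x,y,w)\iff I(x)=I(y)$ and $I(w)\subseteq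 I(y)$. $\longleftrightarrow_Z$ is the least reflexive and transitive relation such that $ap+a(q+r)+s\longleftrightarrow_Z ap+a(q+r)+a(p+q)+s$ whenever $M_Z(p,q,r)$ (for any $a,p,q,r,s$). Then $p\overset{a}{\Rightarrow}_Z q$ iff there is $p'$ with $p\longleftrightarrow_Z p'$ and $p'\xrightarrow{a}q$. A ready simulation on $\Rightarrow_Z$ is a relation $R$ such that $pRq$ implies $\{a\mid \exists p'.\,p\overset{a}{\Rightarrow}_Z p'\}=\{a\mid\exists q'.\,q\overset{a}{\Rightarrow}_Z q'\}$ and for every $p\overset{a}{\Rightarrow}_Z p'$ there is $q\overset{a}{\Rightarrow}_Z q'$ with $p'Rq'$; $p\sqsubseteq_{RS}^{\Rightarrow_Z}q$ iff such $R$ with $pRq$ exists. *)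

theory Defs
  imports Main
begin

datatype 'act bccsp_term =
    Nil_term
  | Prefix_term 'act "'act bccsp_term"
  | Choice_term "'act bccsp_term" "'act bccsp_term"

text \<open>Provable equality from the four axioms, i.e. the least congruence containing them.\<close>

inductive bccsp_eq :: "'act bccsp_term \<Rightarrow> 'act bccsp_term \<Rightarrow> bool" where
  comm: "bccsp_eq (Choice_term x y) (Choice_term y x)"
| assoc: "bccsp_eq (Choice_term (Choice_term x y) z) (Choice_term x (Choice_term y z))"
| idem: "bccsp_eq (Choice_term x x) x"
| unit: "bccsp_eq (Choice_term x Nil_term) x"
| refl: "bccsp_eq x x"
| sym: "bccsp_eq x y \<Longrightarrow> bccsp_eq y x"
| trans: "bccsp_eq x y \<Longrightarrow> bccsp_eq y z \<Longrightarrow> bccsp_eq x z"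
| prefix_cong: "bccsp_eq x y \<Longrightarrow> bccsp_eq (Prefix_term a x) (Prefix_term a y)"
| choice_cong: "bccsp_eq x x' \<Longrightarrow> bccsp_eq y y' \<Longrightarrow> bccsp_eq (Choice_term x y) (Choice_term x' y')"

lemma equivp_bccsp_eq: "equivp bccsp_eq"
  by (intro equivpI reflpI sympI transpI) (blast intro: bccsp_eq.intros)+

quotient_type 'act bccsp = "'act bccsp_term" / bccsp_eq
  by (rule equivp_bccsp_eq)

lift_definition prefix :: "'act \<Rightarrow> 'act bccsp \<Rightarrow> 'act bccsp" is Prefix_term
  by (rule bccsp_eq.prefix_cong)

text \<open>The process \<open>0\<close> and the choice operator are the zero and the addition of \<open>comm_monoid_add\<close>.\<close>

instantiation bccsp :: (type) comm_monoid_add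
begin

lift_definition zero_bccsp :: "'a bccsp" is Nil_term .

lift_definition plus_bccsp :: "'a bccsp \<Rightarrow> 'a bccsp \<Rightarrow> 'a bccsp" is Choice_term
  by (rule bccsp_eq.choice_cong)

instance
proof
  fix x y z :: "'a bccsp"
  show "x + y + z = x + (y + z)"
    by transfer (rule bccsp_eq.assoc)
  show "x + y = y + x"
    by transfer (rule bccsp_eq.comm)
  show "0 + x = x"
    by transfer (blast intro: bccsp_eq.intros)
qed

end

lemma bccsp_choice_idem: "x + x = (x :: 'act bccsp)"
  by transfer (rule bccsp_eq.idem)

lemma bccsp_induct [case_names zero prefix plus]:
  fixes p :: "'act bccsp"
  assumes "P 0"
    and "\<And>a p. P p \<Longrightarrow> P (prefix a p)"
    and "\<And>p q. P p \<Longrightarrow> P q \<Longrightarrow> P (p + q)"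
  shows "P p"
proof (induction p rule: bccsp.abs_induct)
  case (1 t)
  show ?case
  proof (induction t)
    case Nil_term
    then show ?case using assms(1) by (simp add: zero_bccsp_def)
  next
    case (Prefix_term a t)
    then show ?case using assms(2) by (metis prefix.abs_eq)
  next
    case (Choice_term s t)
    then show ?case using assms(3) by (metis plus_bccsp.abs_eq)
  qed
qed

text \<open>
  The transition rules are read on processes, i.e. on equivalence classes of terms; the result
  is the image under the quotient map of the transition relation on terms.
\<close>

inductive step :: "'act bccsp \<Rightarrow> 'act \<Rightarrow> 'act bccsp \<Rightarrow> bool" where
  prefix: "step (prefix a p) a p"
| choice_left: "step p a p' \<Longrightarrow> step (p + q) a p'"
| choice_right: "step p a p' \<Longrightarrow> step (q + p) a p'"

inductive steps :: "'act bccsp \<Rightarrow> 'act list \<Rightarrow> 'act bccsp \<Rightarrow> bool" where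
  Nil: "steps p [] p"
| Cons: "step p a p' \<Longrightarrow> steps p' as q \<Longrightarrow> steps p (a # as) q"

definition initials_of :: "('p \<Rightarrow> 'act \<Rightarrow> 'p \<Rightarrow> bool) \<Rightarrow> 'p \<Rightarrow> 'act set" where
  "initials_of T p = {a. \<exists>p'. T p a p'}"

abbreviation initials :: "'act bccsp \<Rightarrow> 'act set" where
  "initials \<equiv> initials_of step"

definition failures :: "'act bccsp \<Rightarrow> ('act list \<times> 'act set) set" where
  "failures p = {(\<alpha>, X). \<exists>p'. steps p \<alpha> p' \<and> initials p' \<inter> X = {}}"

definition readies :: "'act bccsp \<Rightarrow> ('act list \<times> 'act set) set" where
  "readies p = {(\<alpha>, X). \<exists>p'. steps p \<alpha> p' \<and> initials p' = X}"

text \<open>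
  \<open>is_path p as ps\<close>: the list \<open>ps\<close> of \<open>length as + 1\<close> processes is the sequence of states
  visited along a path from \<open>p\<close> labelled by \<open>as\<close>; the label \<open>as ! i\<close> leads from \<open>ps ! i\<close> to
  \<open>ps ! Suc i\<close>.
\<close>

definition is_path :: "'act bccsp \<Rightarrow> 'act list \<Rightarrow> 'act bccsp list \<Rightarrow> bool" where
  "is_path p as ps \<longleftrightarrow>
     length ps = Suc (length as) \<and> ps ! 0 = p \<and>
     (\<forall>i < length as. step (ps ! i) (as ! i) (ps ! Suc i))"

text \<open>
  A sequence \<open>X\<^sub>0 a\<^sub>1 X\<^sub>1 \<dots> a\<^sub>n X\<^sub>n\<close> is encoded as the pair of the list of actions
  \<open>[a\<^sub>1, \<dots>, a\<^sub>n]\<close> and the list of sets \<open>[X\<^sub>0, \<dots>, X\<^sub>n]\<close>.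
\<close>

definition failure_traces :: "'act bccsp \<Rightarrow> ('act list \<times> 'act set list) set" where
  "failure_traces p =
     {(as, Xs). length Xs = Suc (length as) \<and>
        (\<exists>ps. is_path p as ps \<and> (\<forall>i \<le> length as. initials (ps ! i) \<inter> Xs ! i = {}))}"

definition ready_traces :: "'act bccsp \<Rightarrow> ('act list \<times> 'act set list) set" where
  "ready_traces p =
     {(as, Xs). length Xs = Suc (length as) \<and>
        (\<exists>ps. is_path p as ps \<and> (\<forall>i \<le> length as. initials (ps ! i) = Xs ! i))}"

datatype semantics = Failures | Readiness | Failure_Trace | Ready_Trace

fun sem_le :: "semantics \<Rightarrow> 'act bccsp \<Rightarrow> 'act bccsp \<Rightarrow> bool" where
  "sem_le Failures p q \<longleftrightarrow> failures p \<subseteq> failures q"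
| "sem_le Readiness p q \<longleftrightarrow> readies p \<subseteq> readies q"
| "sem_le Failure_Trace p q \<longleftrightarrow> failure_traces p \<subseteq> failure_traces q"
| "sem_le Ready_Trace p q \<longleftrightarrow> ready_traces p \<subseteq> ready_traces q"

fun cond :: "semantics \<Rightarrow> 'act bccsp \<Rightarrow> 'act bccsp \<Rightarrow> 'act bccsp \<Rightarrow> bool" where
  "cond Failures x y w \<longleftrightarrow> True"
| "cond Readiness x y w \<longleftrightarrow> initials y \<subseteq> initials x"
| "cond Failure_Trace x y w \<longleftrightarrow> initials w \<subseteq> initials y"
| "cond Ready_Trace x y w \<longleftrightarrow> initials x = initials y \<and> initials w \<subseteq> initials y"

text \<open>
  This relation is neither symmetric nor closed under prefixing.
\<close>

inductive rewr :: "semantics \<Rightarrow> 'act bccsp \<Rightarrow> 'act bccsp \<Rightarrow> bool" for Z where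
  refl: "rewr Z p p"
| trans: "rewr Z p p' \<Longrightarrow> rewr Z p' p'' \<Longrightarrow> rewr Z p p''"
| expand: "cond Z p q r \<Longrightarrow>
    rewr Z (prefix a p + prefix a (q + r) + s)
           (prefix a p + prefix a (q + r) + prefix a (p + q) + s)"

definition sem_step :: "semantics \<Rightarrow> 'act bccsp \<Rightarrow> 'act \<Rightarrow> 'act bccsp \<Rightarrow> bool" where
  "sem_step Z p a q \<longleftrightarrow> (\<exists>p'. rewr Z p p' \<and> step p' a q)"

definition ready_simulation ::
    "('p \<Rightarrow> 'act \<Rightarrow> 'p \<Rightarrow> bool) \<Rightarrow> ('p \<Rightarrow> 'p \<Rightarrow> bool) \<Rightarrow> bool" where
  "ready_simulation T R \<longleftrightarrow>
     (\<forall>p q. R p q \<longrightarrow>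
        initials_of T p = initials_of T q \<and>
        (\<forall>a p'. T p a p' \<longrightarrow> (\<exists>q'. T q a q' \<and> R p' q')))"

definition ready_sim_le :: "('p \<Rightarrow> 'act \<Rightarrow> 'p \<Rightarrow> bool) \<Rightarrow> 'p \<Rightarrow> 'p \<Rightarrow> bool" where
  "ready_sim_le T p q \<longleftrightarrow> (\<exists>R. ready_simulation T R \<and> R p q)"

end

theory Submission
  imports Defs
begin

text \<open>
  All four semantics are inclusions of observations built from the two relations \<open>fin_rel\<close>
  (for the last ready set of a path) and \<open>mid_rel\<close> (for the earlier ones).
  Rewriting creates no new observations, which gives soundness. For completeness, \<open>\<sqsubseteq>\<^sub>Z\<close> itself is
  a ready simulation: if \<open>p \<sqsubseteq>\<^sub>Z q\<close> and \<open>p\<close> moves to \<open>p'\<close> by \<open>a\<close>, let \<open>B = I(p')\<close>, start from an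
  \<open>a\<close>-successor of \<open>q\<close> matching the observation \<open>B\<close> of \<open>p'\<close>, and add to it, one rewrite at a time, the
  part with initial actions in \<open>B\<close> of every \<open>a\<close>-successor of \<open>q\<close> whose ready set is
  \<open>mid_rel\<close>-related to \<open>B\<close>. The resulting process has all observations of \<open>p'\<close>.
\<close>

section \<open>Transitions on the quotient\<close>

text \<open>
  The rules of \<open>step\<close> cannot be inverted directly, since \<open>prefix\<close> and \<open>+\<close> are not free
  constructors; instead the set of transitions is computed on terms and lifted.
\<close>

fun term_derivs :: "'act bccsp_term \<Rightarrow> ('act \<times> 'act bccsp) set" where
  "term_derivs Nil_term = {}"
| "term_derivs (Prefix_term a t) = {(a, abs_bccsp t)}"
| "term_derivs (Choice_term s t) = term_derivs s \<union> term_derivs t"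

text \<open>Residuals are stored as equivalence classes, which settles prefix congruence, and union
  satisfies the four axioms.\<close>

lemma term_derivs_cong: "bccsp_eq s t \<Longrightarrow> term_derivs s = term_derivs t"
  by (induction rule: bccsp_eq.induct) (auto simp: bccsp.abs_eq_iff)

lift_definition derivs :: "'act bccsp \<Rightarrow> ('act \<times> 'act bccsp) set" is term_derivs
  by (rule term_derivs_cong)

lemma derivs_zero: "derivs 0 = {}"
  by (simp add: zero_bccsp_def derivs.abs_eq)

lemma derivs_prefix: "derivs (prefix a p) = {(a, p)}"
  by (induction p rule: bccsp.abs_induct) (simp add: prefix.abs_eq derivs.abs_eq)

lemma derivs_plus: "derivs (p + q) = derivs p \<union> derivs q"
  by transfer simp

lemma step_iff_derivs: "step p a p' \<longleftrightarrow> (a, p') \<in> derivs p"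
proof
  show "step p a p' \<Longrightarrow> (a, p') \<in> derivs p"
    by (induction rule: step.induct) (auto simp: derivs_prefix derivs_plus)
  show "(a, p') \<in> derivs p \<Longrightarrow> step p a p'"
    by (induction p rule: bccsp_induct)
      (auto simp: derivs_zero derivs_prefix derivs_plus intro: step.intros)
qed

lemma step_zero [simp]: "\<not> step 0 a p'"
  by (simp add: step_iff_derivs derivs_zero)

lemma step_prefix_iff [simp]: "step (prefix a p) b p' \<longleftrightarrow> b = a \<and> p' = p"
  by (simp add: step_iff_derivs derivs_prefix)

lemma step_plus_iff [simp]: "step (p + q) a p' \<longleftrightarrow> step p a p' \<or> step q a p'"
  by (simp add: step_iff_derivs derivs_plus)

lemma finite_derivs: "finite (derivs p)"
  by (induction p rule: bccsp_induct) (simp_all add: derivs_zero derivs_prefix derivs_plus)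

lemma finite_step: "finite {p'. step p a p'}"
proof -
  have "{p'. step p a p'} \<subseteq> snd ` derivs p"
    by (force simp: step_iff_derivs)
  then show ?thesis
    using finite_derivs finite_surj by blast
qed

lemma initials_zero [simp]: "initials 0 = {}"
  by (simp add: initials_of_def)

lemma initials_prefix [simp]: "initials (prefix a p) = {a}"
  by (simp add: initials_of_def)

lemma initials_plus [simp]: "initials (p + q) = initials p \<union> initials q"
  by (auto simp: initials_of_def)

lemma in_initials: "step p a p' \<Longrightarrow> a \<in> initials p"
  by (auto simp: initials_of_def)

text \<open>Idempotence absorbs a second copy of a summand already present in \<open>p\<close>. This
  brings \<open>p\<close> into the shape that \<open>expand\<close> requires.\<close>

lemma step_absorb: "step p a p' \<Longrightarrow> prefix a p' + p = p"
proof (induction rule: step.induct)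
  case (prefix a p)
  then show ?case by (rule bccsp_choice_idem)
next
  case (choice_left p a p' q)
  then show ?case by (metis add.assoc)
next
  case (choice_right p a p' q)
  then show ?case by (metis add.left_commute)
qed

text \<open>Sort the prefix summands by whether their action lies in \<open>B\<close>. The two
  groups later serve as the second and third arguments of \<open>cond\<close>.\<close>

lemma initials_split:
  "\<exists>y r. q = y + r \<and> initials y = initials q \<inter> B \<and> initials r = initials q - B \<and>
     (\<forall>b\<in>B. \<forall>x. step q b x \<longrightarrow> step y b x)"
proof (induction q rule: bccsp_induct)
  case zero
  show ?case by (intro exI[of _ 0]) simp
next
  case (prefix a p)
  show ?case
  proof (cases "a \<in> B")
    case True
    then show ?thesis by (intro exI[of _ "prefix a p"] exI[of _ 0]) auto
  next
    case False
    \<comment> \<open>Now \<open>y\<close> is \<open>0\<close> and \<open>r\<close> is the prefix;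
      backtracking finds this order.\<close>
    then show ?thesis by (intro exI[of _ "prefix a p"] exI[of _ 0]) auto
  qed
next
  case (plus p q)
  obtain y r where
    p: "p = y + r" "initials y = initials p \<inter> B" "initials r = initials p - B"
      "\<forall>b\<in>B. \<forall>x. step p b x \<longrightarrow> step y b x"
    using plus.IH(1) by (elim exE conjE)
  obtain y' r' where
    q: "q = y' + r'" "initials y' = initials q \<inter> B" "initials r' = initials q - B"
      "\<forall>b\<in>B. \<forall>x. step q b x \<longrightarrow> step y' b x"
    using plus.IH(2) by (elim exE conjE)
  have "p + q = (y + y') + (r + r')"
    unfolding p(1) q(1) by (simp add: ac_simps)
  moreover have "initials (y + y') = initials (p + q) \<inter> B"
    and "initials (r + r') = initials (p + q) - B"
    unfolding initials_plus p(2,3) q(2,3) by blast+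
  moreover have "\<forall>b\<in>B. \<forall>x. step (p + q) b x \<longrightarrow> step (y + y') b x"
    unfolding step_plus_iff using p(4) q(4) by blast
  ultimately show ?case by blast
qed

section \<open>Observations\<close>

fun fin_rel :: "semantics \<Rightarrow> 'act set \<Rightarrow> 'act set \<Rightarrow> bool" where
  "fin_rel Failures = (\<subseteq>)"
| "fin_rel Readiness = (=)"
| "fin_rel Failure_Trace = (\<subseteq>)"
| "fin_rel Ready_Trace = (=)"

text \<open>Trivial for the two semantics that inspect only the end of a path; their earlier sets
  are mere fillers.\<close>

fun mid_rel :: "semantics \<Rightarrow> 'act set \<Rightarrow> 'act set \<Rightarrow> bool" where
  "mid_rel Failures = (\<lambda>A B. True)"
| "mid_rel Readiness = (\<lambda>A B. True)"
| "mid_rel Failure_Trace = (\<subseteq>)"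
| "mid_rel Ready_Trace = (=)"

text \<open>
  Failure sets are complemented here: refusing \<open>X\<close> is the observation \<open>- X\<close>.
\<close>

fun obs :: "semantics \<Rightarrow> 'act set \<Rightarrow> ('act \<times> 'act set) list \<Rightarrow> 'act bccsp \<Rightarrow> bool" where
  "obs Z X [] p \<longleftrightarrow> fin_rel Z (initials p) X"
| "obs Z X ((a, Y) # w) p \<longleftrightarrow> mid_rel Z (initials p) X \<and> (\<exists>p'. step p a p' \<and> obs Z Y w p')"

lemma fin_rel_refl [simp]: "fin_rel Z A A"
  by (cases Z) auto

lemma mid_rel_refl [simp]: "mid_rel Z A A"
  by (cases Z) auto

lemma fin_rel_subset: "fin_rel Z A B \<Longrightarrow> A \<subseteq> B"
  by (cases Z) auto

lemma fin_rel_trans: "fin_rel Z A B \<Longrightarrow> fin_rel Z B C \<Longrightarrow> fin_rel Z A C"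
  by (cases Z) auto

text \<open>\<open>fin_rel\<close> implies \<open>mid_rel\<close>, and the latter is
  transitive.\<close>

lemma mid_rel_trans: "fin_rel Z A B \<Longrightarrow> mid_rel Z B C \<Longrightarrow> mid_rel Z A C"
  by (cases Z) auto

section \<open>Unfolding the four observation sets along the first transition\<close>

lemma steps_Nil_iff [simp]: "steps p [] q \<longleftrightarrow> q = p"
  by (auto elim: steps.cases intro: steps.intros)

lemma steps_Cons_iff [simp]: "steps p (a # as) q \<longleftrightarrow> (\<exists>p'. step p a p' \<and> steps p' as q)"
  by (auto elim: steps.cases intro: steps.intros)

lemma is_path_Nil_iff: "is_path p [] ps \<longleftrightarrow> ps = [p]"
  by (auto simp: is_path_def length_Suc_conv)

lemma is_path_Cons_iff:
  "is_path p (a # as) ps \<longleftrightarrow> (\<exists>p' ps'. ps = p # ps' \<and> step p a p' \<and> is_path p' as ps')"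
proof
  assume path: "is_path p (a # as) ps"
  then obtain ps' where ps: "ps = p # ps'"
    by (cases ps) (auto simp: is_path_def)
  have step: "step ((p # ps') ! i) ((a # as) ! i) ((p # ps') ! Suc i)" if "i < Suc (length as)" for i
    using path that by (simp add: is_path_def ps)
  have "step p a (ps' ! 0)"
    using step[of 0] by simp
  moreover have "is_path (ps' ! 0) as ps'"
    using path step[of "Suc _"] by (simp add: is_path_def ps)
  ultimately show "\<exists>p' ps'. ps = p # ps' \<and> step p a p' \<and> is_path p' as ps'"
    using ps by blast
next
  assume "\<exists>p' ps'. ps = p # ps' \<and> step p a p' \<and> is_path p' as ps'"
  then show "is_path p (a # as) ps"
    by (auto simp: is_path_def nth_Cons' less_Suc_eq_0_disj)
qed

text \<open>\<open>Q\<close> is kept abstract so that disjointness and equality are treated at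
  once.\<close>

lemma path_sets_Cons:
  "(\<exists>ps. is_path p (a # as) ps \<and> (\<forall>i \<le> Suc (length as). Q (initials (ps ! i)) ((X # Xs) ! i))) \<longleftrightarrow>
     Q (initials p) X \<and> (\<exists>p'. step p a p' \<and>
       (\<exists>ps. is_path p' as ps \<and> (\<forall>i \<le> length as. Q (initials (ps ! i)) (Xs ! i))))"
proof -
  have all_Suc: "(\<forall>i \<le> Suc n. P i) \<longleftrightarrow> P 0 \<and> (\<forall>i \<le> n. P (Suc i))" for P and n :: nat
    by (metis Suc_le_mono not0_implies_Suc zero_le)
  have "(\<exists>ps. is_path p (a # as) ps \<and>
        (\<forall>i \<le> Suc (length as). Q (initials (ps ! i)) ((X # Xs) ! i))) \<longleftrightarrow>
      (\<exists>p' ps. step p a p' \<and> is_path p' as ps \<and>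
        (\<forall>i \<le> Suc (length as). Q (initials ((p # ps) ! i)) ((X # Xs) ! i)))"
    unfolding is_path_Cons_iff by blast
  then show ?thesis
    unfolding all_Suc nth_Cons_0 nth_Cons_Suc by blast
qed

lemma failures_Cons_iff:
  "(a # as, X) \<in> failures p \<longleftrightarrow> (\<exists>p'. step p a p' \<and> (as, X) \<in> failures p')"
  by (simp add: failures_def) blast

lemma readies_Cons_iff:
  "(a # as, X) \<in> readies p \<longleftrightarrow> (\<exists>p'. step p a p' \<and> (as, X) \<in> readies p')"
  by (simp add: readies_def) blast

lemma failure_traces_Cons_iff:
  "(a # as, X # Xs) \<in> failure_traces p \<longleftrightarrow>
     initials p \<inter> X = {} \<and> (\<exists>p'. step p a p' \<and> (as, Xs) \<in> failure_traces p')"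
  using path_sets_Cons[of p a as "\<lambda>A B. A \<inter> B = {}" X Xs]
  by (simp add: failure_traces_def) blast

lemma ready_traces_Cons_iff:
  "(a # as, X # Xs) \<in> ready_traces p \<longleftrightarrow>
     initials p = X \<and> (\<exists>p'. step p a p' \<and> (as, Xs) \<in> ready_traces p')"
  using path_sets_Cons[of p a as "(=)" X Xs]
  by (simp add: ready_traces_def) blast

text \<open>Earlier sets are ignored by \<open>mid_rel\<close>, so only the last one survives;
  disjointness is inclusion in the complement.\<close>

lemma obs_Failures: "obs Failures X w p \<longleftrightarrow> (map fst w, - last (X # map snd w)) \<in> failures p"
proof (induction w arbitrary: X p)
  case Nil
  show ?case by (auto simp: failures_def)
next
  case (Cons aY w)
  then show ?case by (cases aY) (simp add: failures_Cons_iff)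
qed

lemma obs_Readiness: "obs Readiness X w p \<longleftrightarrow> (map fst w, last (X # map snd w)) \<in> readies p"
proof (induction w arbitrary: X p)
  case Nil
  show ?case by (auto simp: readies_def)
next
  case (Cons aY w)
  then show ?case by (cases aY) (simp add: readies_Cons_iff)
qed

lemma obs_Failure_Trace:
  "obs Failure_Trace X w p \<longleftrightarrow> (map fst w, map uminus (X # map snd w)) \<in> failure_traces p"
proof (induction w arbitrary: X p)
  case Nil
  show ?case by (auto simp: failure_traces_def is_path_Nil_iff)
next
  case (Cons aY w)
  then show ?case
    by (cases aY) (simp add: failure_traces_Cons_iff disjoint_eq_subset_Compl)
qed

lemma obs_Ready_Trace:
  "obs Ready_Trace X w p \<longleftrightarrow> (map fst w, X # map snd w) \<in> ready_traces p"
proof (induction w arbitrary: X p)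
  case Nil
  show ?case by (auto simp: ready_traces_def is_path_Nil_iff)
next
  case (Cons aY w)
  then show ?case by (cases aY) (simp add: ready_traces_Cons_iff)
qed

lemma obtain_last_sets:
  obtains X w where "as = map fst w" and "Y = last (X # map snd w)"
proof -
  \<comment> \<open>\<open>Y\<close> fills every position, including the initial one, so that the
    empty action list also ends in \<open>Y\<close>.\<close>
  define w where "w = map (\<lambda>a. (a, Y)) as"
  have "last (Y # map snd w) = Y"
    by (cases "w = []") (auto simp: w_def last_map)
  moreover have "as = map fst w"
    by (simp add: w_def comp_def)
  ultimately show thesis
    using that by metis
qed

lemma obtain_trace_sets:
  assumes "length Xs = Suc (length as)"
  obtains X w where "as = map fst w" and "Xs = X # map snd w"
proof -
  obtain X Ys where Xs: "Xs = X # Ys" "length Ys = length as"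
    using assms by (auto simp: length_Suc_conv)
  show thesis
    by (rule that[of "zip as Ys" X]) (use Xs in simp_all)
qed

text \<open>The encodings are onto: every pair or trace arises from some \<open>X\<close> and
  \<open>w\<close>, up to complementing sets.\<close>

lemma sem_le_iff_obs: "sem_le Z p q \<longleftrightarrow> (\<forall>X w. obs Z X w p \<longrightarrow> obs Z X w q)"
proof (cases Z)
  case Failures
  have "failures p \<subseteq> failures q" if *: "\<forall>X w. obs Failures X w p \<longrightarrow> obs Failures X w q"
  proof (rule subrelI)
    fix as Y assume "(as, Y) \<in> failures p"
    moreover obtain X w where "as = map fst w" "- Y = last (X # map snd w)"
      by (rule obtain_last_sets)
    ultimately show "(as, Y) \<in> failures q"
      using * unfolding obs_Failures by (metis double_complement)
  qed
  then show ?thesis unfolding Failures sem_le.simps obs_Failures by blast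
next
  case Readiness
  have "readies p \<subseteq> readies q" if *: "\<forall>X w. obs Readiness X w p \<longrightarrow> obs Readiness X w q"
  proof (rule subrelI)
    fix as Y assume "(as, Y) \<in> readies p"
    moreover obtain X w where "as = map fst w" "Y = last (X # map snd w)"
      by (rule obtain_last_sets)
    ultimately show "(as, Y) \<in> readies q"
      using * unfolding obs_Readiness by metis
  qed
  then show ?thesis unfolding Readiness sem_le.simps obs_Readiness by blast
next
  case Failure_Trace
  have "failure_traces p \<subseteq> failure_traces q"
    if *: "\<forall>X w. obs Failure_Trace X w p \<longrightarrow> obs Failure_Trace X w q"
  proof (rule subrelI)
    fix as Xs assume mem: "(as, Xs) \<in> failure_traces p"
    then have "length (map uminus Xs) = Suc (length as)"
      by (simp add: failure_traces_def)
    then obtain X w where w: "as = map fst w" "map uminus Xs = X # map snd w"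
      by (rule obtain_trace_sets)
    have "map uminus (X # map snd w) = Xs"
      unfolding w(2)[symmetric] by (simp add: comp_def)
    then show "(as, Xs) \<in> failure_traces q"
      using mem * w(1) unfolding obs_Failure_Trace by metis
  qed
  then show ?thesis unfolding Failure_Trace sem_le.simps obs_Failure_Trace by blast
next
  case Ready_Trace
  have "ready_traces p \<subseteq> ready_traces q"
    if *: "\<forall>X w. obs Ready_Trace X w p \<longrightarrow> obs Ready_Trace X w q"
  proof (rule subrelI)
    fix as Xs assume mem: "(as, Xs) \<in> ready_traces p"
    then have "length Xs = Suc (length as)"
      by (simp add: ready_traces_def)
    then obtain X w where "as = map fst w" "Xs = X # map snd w"
      by (rule obtain_trace_sets)
    then show "(as, Xs) \<in> ready_traces q"
      using mem * unfolding obs_Ready_Trace by metis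
  qed
  then show ?thesis unfolding Ready_Trace sem_le.simps obs_Ready_Trace by blast
qed

lemma sem_le_obs: "sem_le Z p q \<Longrightarrow> obs Z X w p \<Longrightarrow> obs Z X w q"
  by (simp add: sem_le_iff_obs)

text \<open>The observation with empty word bounds \<open>initials q\<close> from above; one-step
  observations supply each initial action of \<open>p\<close>.\<close>

lemma sem_le_initials:
  assumes "sem_le Z p q"
  shows "initials p = initials q"
proof
  have "obs Z (initials p) [] q"
    by (rule sem_le_obs[OF assms]) simp
  then show "initials q \<subseteq> initials p"
    by (simp add: fin_rel_subset)
  show "initials p \<subseteq> initials q"
  proof
    fix a assume "a \<in> initials p"
    then obtain p' where "step p a p'"
      by (auto simp: initials_of_def)
    then have "obs Z (initials p) [(a, initials p')] p"
      by auto
    then have "obs Z (initials p) [(a, initials p')] q"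
      by (rule sem_le_obs[OF assms])
    then show "a \<in> initials q"
      by (auto intro: in_initials)
  qed
qed

section \<open>Soundness of rewriting\<close>

lemma rewr_initials: "rewr Z p u \<Longrightarrow> initials u = initials p"
  by (induction rule: rewr.induct) auto

text \<open>A first move of \<open>p + q\<close> comes from \<open>p\<close> or \<open>q\<close>,
  and \<open>cond\<close> makes the sets fit: for failure traces
  \<open>initials (q + r) = initials q\<close>, for ready traces all three ready sets agree. For the
  empty word \<open>p\<close> suffices, by \<open>initials q \<subseteq> initials p\<close> in the
  case of readiness.\<close>

lemma obs_cond_plus:
  assumes "cond Z p q r" and "obs Z X w (p + q)"
  shows "obs Z X w p \<or> obs Z X w (q + r)"
proof (cases w)
  case Nil
  then show ?thesis using assms by (cases Z) auto
next
  case (Cons aY w')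
  obtain a Y where "aY = (a, Y)" by fastforce
  then show ?thesis using assms Cons by (cases Z) auto
qed

text \<open>An observation entering the new summand \<open>prefix a (p + q)\<close> is rerouted
  through one of the two old ones.\<close>

lemma rewr_obs: "rewr Z p u \<Longrightarrow> obs Z X w u \<Longrightarrow> obs Z X w p"
proof (induction arbitrary: X w rule: rewr.induct)
  case (expand p q r a s)
  show ?case
  proof (cases w)
    case Nil
    then show ?thesis using expand.prems by simp
  next
    case (Cons bY w')
    obtain b Y where "bY = (b, Y)" by fastforce
    then show ?thesis
      using expand.prems Cons obs_cond_plus[OF expand.hyps, of Y w'] by auto
  qed
qed auto

lemma sem_step_initials: "initials_of (sem_step Z) p = initials p"
  unfolding initials_of_def sem_step_def
  using rewr_initials rewr.refl by (fastforce simp: initials_of_def)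

text \<open>Follow \<open>w\<close> along the simulation. Each answering move starts from a rewrite
  \<open>u\<close> of \<open>q\<close>, and the observation of \<open>u\<close> is pulled back to
  \<open>q\<close>.\<close>

lemma ready_simulation_obs:
  assumes sim: "ready_simulation (sem_step Z) R"
  shows "R p q \<Longrightarrow> obs Z X w p \<Longrightarrow> obs Z X w q"
proof (induction w arbitrary: X p q)
  case Nil
  then have "initials p = initials q"
    using sim by (auto simp: ready_simulation_def sem_step_initials)
  then show ?case using Nil by simp
next
  case (Cons aY w)
  obtain a Y where aY: "aY = (a, Y)" by fastforce
  have I: "initials p = initials q"
    using sim Cons.prems by (auto simp: ready_simulation_def sem_step_initials)
  obtain p' where p': "mid_rel Z (initials p) X" "step p a p'" "obs Z Y w p'"
    using Cons.prems aY by auto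
  have "sem_step Z p a p'"
    using p'(2) rewr.refl by (auto simp: sem_step_def)
  then obtain q' where q': "sem_step Z q a q'" "R p' q'"
    using sim Cons.prems(1) unfolding ready_simulation_def by blast
  then obtain u where u: "rewr Z q u" "step u a q'"
    by (auto simp: sem_step_def)
  have "obs Z Y w q'"
    using Cons.IH q'(2) p'(3) .
  then have "obs Z X (aY # w) u"
    using u p'(1) I rewr_initials[OF u(1)] aY by auto
  then show ?case
    by (rule rewr_obs[OF u(1)])
qed

section \<open>Completeness of rewriting\<close>

text \<open>Take \<open>s\<close> to be \<open>u\<close> in \<open>expand\<close>: the two summands
  on the left are absorbed.\<close>

lemma rewr_add:
  assumes "step u a x" and "step u a (y + r)" and "cond Z x y r"
  shows "rewr Z u (u + prefix a (x + y))"
proof -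
  have u: "prefix a x + prefix a (y + r) + u = u"
    using assms by (simp add: add.assoc step_absorb)
  have "prefix a x + prefix a (y + r) + prefix a (x + y) + u =
      (prefix a x + prefix a (y + r) + u) + prefix a (x + y)"
    by (simp add: ac_simps)
  with rewr.expand[OF assms(3), of a u] show ?thesis
    by (simp add: u)
qed

text \<open>Since \<open>u\<close> keeps the \<open>a\<close>-successors of \<open>q\<close>, each
  element of \<open>S\<close> is still available when its turn comes.\<close>

lemma rewr_combine:
  assumes "finite S" and "\<forall>x\<in>S. step q a x \<and> mid_rel Z (initials x) B"
    and "step q a q0" and "fin_rel Z (initials q0) B"
  shows "\<exists>u q'. rewr Z q u \<and> (\<forall>x. step q a x \<longrightarrow> step u a x) \<and> step u a q' \<and>
    fin_rel Z (initials q') B \<and> (\<forall>x\<in>S. \<forall>b\<in>B. \<forall>x'. step x b x' \<longrightarrow> step q' b x')"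
  using assms(1,2)
proof (induction S rule: finite_induct)
  case empty
  then show ?case using assms(3,4) rewr.refl by blast
next
  case (insert x S)
  then obtain u q' where u: "rewr Z q u" "\<forall>x. step q a x \<longrightarrow> step u a x" "step u a q'"
    and q': "fin_rel Z (initials q') B" "\<forall>x\<in>S. \<forall>b\<in>B. \<forall>x'. step x b x' \<longrightarrow> step q' b x'"
    by auto
  obtain y r where x: "x = y + r" and y: "initials y = initials x \<inter> B"
    and r: "initials r = initials x - B" and y_step: "\<forall>b\<in>B. \<forall>x'. step x b x' \<longrightarrow> step y b x'"
    using initials_split[of x B] by blast
  have mid: "mid_rel Z (initials x) B" and "step u a (y + r)"
    using insert.prems u(2) x by auto
  \<comment> \<open>For readiness, \<open>initials q' = B\<close> contains
    \<open>initials y\<close>. For failure traces, \<open>initials x \<subseteq> B\<close> leaves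
    \<open>initials r\<close> empty. For ready traces, moreover,
    \<open>initials y = B = initials q'\<close>.\<close>
  moreover have "cond Z q' y r"
    using mid q'(1) y r by (cases Z) auto
  ultimately have "rewr Z q (u + prefix a (q' + y))"
    using rewr.trans[OF u(1)] rewr_add[OF u(3)] by blast
  moreover have "fin_rel Z (initials (q' + y)) B"
    using q'(1) y by (cases Z) auto
  ultimately show ?case
    using u(2) q'(2) y_step
    by (intro exI[of _ "u + prefix a (q' + y)"] exI[of _ "q' + y"]) auto
qed

lemma sem_le_step:
  assumes le: "sem_le Z p q" and p': "step p a p'"
  shows "\<exists>q'. sem_step Z q a q' \<and> sem_le Z p' q'"
proof -
  define B where "B = initials p'"
  define S where "S = {x. step q a x \<and> mid_rel Z (initials x) B}"
  have "finite S"
    unfolding S_def by (rule finite_subset[OF _ finite_step[of q a]]) auto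
  \<comment> \<open>With \<open>initials p\<close> as the root set, \<open>mid_rel\<close> holds at
    \<open>p\<close> by reflexivity.\<close>
  have lift: "\<exists>x. step q a x \<and> obs Z X w x" if "obs Z X w p'" for X w
  proof -
    have "obs Z (initials p) ((a, X) # w) p"
      using p' that by auto
    then have "obs Z (initials p) ((a, X) # w) q"
      by (rule sem_le_obs[OF le])
    then show ?thesis by auto
  qed
  have "obs Z B [] p'"
    by (simp add: B_def)
  from lift[OF this] obtain q0 where q0: "step q a q0" "fin_rel Z (initials q0) B"
    by auto
  have S: "\<forall>x\<in>S. step q a x \<and> mid_rel Z (initials x) B"
    by (simp add: S_def)
  obtain u q' where u: "rewr Z q u" "step u a q'" and fin: "fin_rel Z (initials q') B"
    and q': "\<forall>x\<in>S. \<forall>b\<in>B. \<forall>x'. step x b x' \<longrightarrow> step q' b x'"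
    using rewr_combine[OF \<open>finite S\<close> S q0] by (elim exE conjE)
  have "obs Z X w q'" if obs: "obs Z X w p'" for X w
  proof (cases w)
    case Nil
    then show ?thesis
      using obs fin fin_rel_trans by (auto simp: B_def)
  next
    case (Cons bY w')
    obtain b Y where bY: "bY = (b, Y)" by fastforce
    \<comment> \<open>The first set \<open>X\<close> is replaced by \<open>B\<close> so that the
      matching successor \<open>x\<close> lies in \<open>S\<close>; \<open>mid_rel Z B X\<close>
      restores \<open>X\<close> at the end.\<close>
    have X: "mid_rel Z B X" and "b \<in> B" and obs_B: "obs Z B ((b, Y) # w') p'"
      using obs Cons bY by (auto simp: B_def intro: in_initials)
    from lift[OF obs_B] obtain x x'
      where "step q a x" "mid_rel Z (initials x) B" "step x b x'" "obs Z Y w' x'"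
      by auto
    then have "step q' b x'"
      using q' \<open>b \<in> B\<close> by (auto simp: S_def)
    then show ?thesis
      using Cons bY \<open>obs Z Y w' x'\<close> mid_rel_trans[OF fin X] by auto
  qed
  then have "sem_le Z p' q'"
    by (simp add: sem_le_iff_obs)
  then show ?thesis
    using u by (auto simp: sem_step_def)
qed

lemma ready_simulation_sem_le: "ready_simulation (sem_step Z) (sem_le Z)"
  unfolding ready_simulation_def
proof (intro allI impI conjI)
  fix p q :: "'act bccsp" and a p'
  assume le: "sem_le Z p q"
  then show "initials_of (sem_step Z) p = initials_of (sem_step Z) q"
    unfolding sem_step_initials by (rule sem_le_initials)
  assume "sem_step Z p a p'"
  then obtain u where u: "rewr Z p u" "step u a p'"
    unfolding sem_step_def by (elim exE conjE)
  \<comment> \<open>By soundness the rewrite can be absorbed into the left-hand side, leaving an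
    ordinary step of \<open>u\<close> to match.\<close>
  have "sem_le Z u q"
    unfolding sem_le_iff_obs by (intro allI impI sem_le_obs[OF le] rewr_obs[OF u(1)])
  then show "\<exists>q'. sem_step Z q a q' \<and> sem_le Z p' q'"
    using u(2) by (rule sem_le_step)
qed

theorem theorem9p10:
  fixes Z :: semantics and p q :: "'act bccsp"
  shows "sem_le Z p q \<longleftrightarrow> ready_sim_le (sem_step Z) p q"
proof
  show "sem_le Z p q \<Longrightarrow> ready_sim_le (sem_step Z) p q"
    unfolding ready_sim_le_def using ready_simulation_sem_le by blast
  show "ready_sim_le (sem_step Z) p q \<Longrightarrow> sem_le Z p q"
    unfolding ready_sim_le_def sem_le_iff_obs using ready_simulation_obs by blast
qed

end
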